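(* There is a primitive recursive function $g:\omega\to\omega$ such that for all $e,m\in\omega$ and all $X$, $$\langle g(e)\rangle^X(m)\downarrow\;\Longleftrightarrow\;\langle e\rangle^X(m)\Downarrow .$$
   Context: **Feedback computation.** Let $X\in{}^{\omega}\omega$ (or ${}^\omega 2$). Programs are ordinary oracle Turing machine programs (with oracle $X$), indexed by $e\in\omega$ in a standard way, with an additional instruction allowing the machine at any stage to issue a query $Q^X(e',m')$, with $e',m'$ integers computed by the machine, asking whether the feedback computation $\langle e'\rangle^X(m')$ converges or diverges, and receiving (in one step) an answer in $\{\downarrow,\uparrow\}$. Formally, for a partial function $C$ let $I(C)$ be the set of pairs $\langle\langle e,m,X\rangle,\langle j,k\rangle\rangle$ such that program $e$, run on input $m$ with oracle $X$, makes only queries $Q^X(e',m')$ for which $C(\langle e',m',X\rangle)=\langle j',k'\rangle$ is defined, each such query being answered by $j'$, and either this run halts with output $k\in\omega$ and $j=\,\downarrow$, or it runs forever and $j=\,\uparrow$, $k=\omega$. Let $I_\infty$ be the least fixed point of the monotone operator $I$, obtained by iteration from $\emptyset$. Write: - $\langle e\rangle^X(m)\downarrow$ (convergent) iff $I_\infty(\langle e,m,X\rangle)=\langle\downarrow,k\rangle$ for some $k\in\omega$; - $\langle e\rangle^X(m)\uparrow$ (divergent) iff $I_\infty(\langle e,m,X\rangle)=\langle\uparrow,\omega\rangle$; - $\langle e\rangle^X(m)\Downarrow$ (defined, non-freezing) iff it is convergent or divergent in this sense, i.e. $\langle e,m,X\rangle\in\mathrm{dom}(I_\infty)$; - $\langle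 e\rangle^X(m)\Uparrow$ (freezing) otherwise. *)

theory Defs
  imports Main "HOL-Library.Nat_Bijection" "HOL-Library.Extended_Nat"
begin

section \<open>Primitive recursive functions\<close>

text \<open>An \<open>n\<close>-ary function is represented by a function on lists, of which only the values on lists
  of length \<open>n\<close> are meaningful. In \<open>prec\<close> the recursion variable is the first argument.\<close>

inductive prim_rec :: "nat \<Rightarrow> (nat list \<Rightarrow> nat) \<Rightarrow> bool" where
  zero: "prim_rec n (\<lambda>_. 0)"
| suc: "prim_rec 1 (\<lambda>xs. Suc (xs ! 0))"
| proj: "i < n \<Longrightarrow> prim_rec n (\<lambda>xs. xs ! i)"
| comp: "prim_rec (length gs) f \<Longrightarrow> (\<forall>g\<in>set gs. prim_rec n g) \<Longrightarrow>
           prim_rec n (\<lambda>xs. f (map (\<lambda>g. g xs) gs))"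
| prec: "prim_rec n f \<Longrightarrow> prim_rec (Suc (Suc n)) h \<Longrightarrow>
           prim_rec (Suc n)
             (\<lambda>xs. rec_nat (f (tl xs)) (\<lambda>y r. h (y # r # tl xs)) (hd xs))"

definition primitive_recursive :: "(nat \<Rightarrow> nat) \<Rightarrow> bool" where
  "primitive_recursive g \<longleftrightarrow> (\<exists>f. prim_rec 1 f \<and> (\<forall>x. g x = f [x]))"


section \<open>Oracle Turing machines with feedback queries\<close>

text \<open>Machines have three two-way infinite tapes over the alphabet \<open>{blank, 1}\<close> (\<open>False\<close> is the
  blank): a work tape, which also carries the input and the output, and two tapes for communicating
  with the oracles. A tape is given by its contents and the position of its head.\<close>

datatype tape_id = Work | Query1 | Query2

type_synonym tape = "(int \<Rightarrow> bool) \<times> int"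

datatype dir = L | N | R

fun shift :: "dir \<Rightarrow> int" where
  "shift L = -1"
| "shift N = 0"
| "shift R = 1"

text \<open>Numbers are written in unary. When a number is read off a tape, all marks on the tape count,
  wherever they are (as in Davis and Soare); a tape occurring in a run only ever carries finitely
  many marks.\<close>

definition number_tape :: "nat \<Rightarrow> tape" where
  "number_tape n = ((\<lambda>i. 0 \<le> i \<and> i < int n), 0)"

definition tape_number :: "tape \<Rightarrow> nat" where
  "tape_number t = card {i. fst t i}"

text \<open>A program is its list of states; a state number outside the list means that the machine has
  halted. In state \<open>Move t u v\<close> the machine scans tape \<open>t\<close> and, according to whether it sees a blank
  or a 1, follows \<open>u\<close> or \<open>v\<close>: such a triple gives the symbol to be written, the move of the head and
  the next state. The instruction \<open>OracleQuery q\<close> takes the number \<open>n\<close> on tape \<open>Query1\<close>, writes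
  \<open>X n\<close> as the new contents of tape \<open>Query2\<close> and continues in state \<open>q\<close>. The instruction
  \<open>FeedbackQuery q r\<close> issues the query \<open>Q\<^sup>X(e', m')\<close> for the numbers \<open>e'\<close>, \<open>m'\<close> on the tapes \<open>Query1\<close>,
  \<open>Query2\<close> and continues in state \<open>q\<close> if the answer is ``convergent'', in state \<open>r\<close> if it is
  ``divergent''.\<close>

type_synonym branch = "bool \<times> dir \<times> nat"

datatype instr =
    Move tape_id branch branch
  | OracleQuery nat
  | FeedbackQuery nat nat

type_synonym program = "instr list"


subsection \<open>Indexing of programs\<close>

definition tape_id_of :: "nat \<Rightarrow> tape_id" where
  "tape_id_of n = (if n mod 3 = 0 then Work else if n mod 3 = 1 then Query1 else Query2)"

definition dir_of :: "nat \<Rightarrow> dir" where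
  "dir_of n = (if n mod 3 = 0 then L else if n mod 3 = 1 then N else R)"

definition branch_of :: "nat \<Rightarrow> branch" where
  "branch_of n = (case prod_decode n of (b, n') \<Rightarrow> case prod_decode n' of (d, q) \<Rightarrow>
     (odd b, dir_of d, q))"

definition instr_of :: "nat \<Rightarrow> instr" where
  "instr_of n = (case prod_decode n of (k, c) \<Rightarrow>
     if k mod 3 = 0 then
       (case prod_decode c of (t, c') \<Rightarrow> case prod_decode c' of (u, v) \<Rightarrow>
          Move (tape_id_of t) (branch_of u) (branch_of v))
     else if k mod 3 = 1 then OracleQuery c
     else (case prod_decode c of (q, r) \<Rightarrow> FeedbackQuery q r))"

definition program_of :: "nat \<Rightarrow> program" where
  "program_of e = map instr_of (list_decode e)"

lemma surj_tape_id_of: "surj tape_id_of"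
proof -
  have "\<exists>n. tape_id_of n = t" for t
    by (cases t)
      (auto simp: tape_id_of_def intro: exI[of _ 0] exI[of _ 1] exI[of _ 2])
  then show ?thesis by (metis surjI)
qed

lemma surj_dir_of: "surj dir_of"
proof -
  have "\<exists>n. dir_of n = d" for d
    by (cases d)
      (auto simp: dir_of_def intro: exI[of _ 0] exI[of _ 1] exI[of _ 2])
  then show ?thesis by (metis surjI)
qed

lemma surj_branch_of: "surj branch_of"
proof -
  have "\<exists>n. branch_of n = x" for x
  proof -
    obtain s d q where x: "x = (s, d, q)" by (cases x)
    obtain n where "dir_of n = d" using surj_dir_of by (metis surjD)
    then have "branch_of (prod_encode (of_bool s, prod_encode (n, q))) = x"
      by (simp add: x branch_of_def)
    then show ?thesis ..
  qed
  then show ?thesis by (metis surjI)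
qed

lemma surj_instr_of: "surj instr_of"
proof -
  have "\<exists>n. instr_of n = x" for x
  proof (cases x)
    case (Move t u v)
    obtain a b c where "tape_id_of a = t" "branch_of b = u" "branch_of c = v"
      using surj_tape_id_of surj_branch_of by (metis surjD)
    then have "instr_of (prod_encode (0, prod_encode (a, prod_encode (b, c)))) = x"
      by (simp add: Move instr_of_def)
    then show ?thesis ..
  next
    case (OracleQuery q)
    then have "instr_of (prod_encode (1, q)) = x"
      by (simp add: instr_of_def)
    then show ?thesis ..
  next
    case (FeedbackQuery q r)
    then have "instr_of (prod_encode (2, prod_encode (q, r))) = x"
      by (simp add: instr_of_def)
    then show ?thesis ..
  qed
  then show ?thesis by (metis surjI)
qed

lemma surj_program_of: "surj program_of"
proof -
  have "\<exists>e. program_of e = p" for p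
  proof -
    have "program_of (list_encode (map (inv instr_of) p)) = p"
      by (simp add: program_of_def surj_f_inv_f[OF surj_instr_of] map_idI)
    then show ?thesis ..
  qed
  then show ?thesis by (metis surjI)
qed


subsection \<open>Runs relative to a given set of answers\<close>

datatype answer = Conv | Div

type_synonym orc = "nat \<Rightarrow> nat"

text \<open>A partial function \<open>C\<close> on triples \<open>\<langle>e, m, X\<rangle>\<close> is represented by its graph. In the pairs
  \<open>\<langle>j, k\<rangle>\<close> the second component is a natural number or \<open>\<infinity>\<close>, the latter standing for \<open>\<omega>\<close>.\<close>

type_synonym answers = "((nat \<times> nat \<times> orc) \<times> (answer \<times> enat)) set"

type_synonym config = "nat \<times> (tape_id \<Rightarrow> tape)"

definition init_config :: "nat \<Rightarrow> config" where
  "init_config m = (0, \<lambda>t. if t = Work then number_tape m else number_tape 0)"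

text \<open>A feedback query on which \<open>C\<close> is undefined leaves the machine without a next configuration;
  as it has not halted either, such a run counts neither as halting nor as running forever.\<close>

inductive step :: "answers \<Rightarrow> program \<Rightarrow> orc \<Rightarrow> config \<Rightarrow> config \<Rightarrow> bool"
  for C p X where
  move: "q < length p \<Longrightarrow> p ! q = Move t u v \<Longrightarrow> T t = (c, i) \<Longrightarrow>
           (if c i then v else u) = (s, d, q') \<Longrightarrow>
           step C p X (q, T) (q', T(t := (c(i := s), i + shift d)))"
| orc_query: "q < length p \<Longrightarrow> p ! q = OracleQuery q' \<Longrightarrow>
           step C p X (q, T) (q', T(Query2 := number_tape (X (tape_number (T Query1)))))"
| feedback: "q < length p \<Longrightarrow> p ! q = FeedbackQuery r s \<Longrightarrow>
           ((tape_number (T Query1), tape_number (T Query2), X), (j, k)) \<in> C \<Longrightarrow>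
           step C p X (q, T) (case j of Conv \<Rightarrow> r | Div \<Rightarrow> s, T)"

definition halts_with :: "answers \<Rightarrow> nat \<Rightarrow> nat \<Rightarrow> orc \<Rightarrow> nat \<Rightarrow> bool" where
  "halts_with C e m X k \<longleftrightarrow>
     (\<exists>q T. (step C (program_of e) X)\<^sup>*\<^sup>* (init_config m) (q, T) \<and>
        q \<ge> length (program_of e) \<and> k = tape_number (T Work))"

definition runs_forever :: "answers \<Rightarrow> nat \<Rightarrow> nat \<Rightarrow> orc \<Rightarrow> bool" where
  "runs_forever C e m X \<longleftrightarrow>
     (\<exists>run. run 0 = init_config m \<and> (\<forall>n. step C (program_of e) X (run n) (run (Suc n))))"


section \<open>Feedback computation\<close>

definition fb_op :: "answers \<Rightarrow> answers" where
  "fb_op C =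
     {((e, m, X), (Conv, enat k)) |e m X k. halts_with C e m X k} \<union>
     {((e, m, X), (Div, \<infinity>)) |e m X. runs_forever C e m X}"

definition fb_inf :: answers where
  "fb_inf = lfp fb_op"

definition fb_convergent :: "nat \<Rightarrow> orc \<Rightarrow> nat \<Rightarrow> bool" where
  "fb_convergent e X m \<longleftrightarrow> (\<exists>k. ((e, m, X), (Conv, enat k)) \<in> fb_inf)"

definition fb_divergent :: "nat \<Rightarrow> orc \<Rightarrow> nat \<Rightarrow> bool" where
  "fb_divergent e X m \<longleftrightarrow> ((e, m, X), (Div, \<infinity>)) \<in> fb_inf"

definition fb_defined :: "nat \<Rightarrow> orc \<Rightarrow> nat \<Rightarrow> bool" where
  "fb_defined e X m \<longleftrightarrow> fb_convergent e X m \<or> fb_divergent e X m"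


subsection \<open>Basic properties\<close>

lemma step_mono: "C \<subseteq> C' \<Longrightarrow> step C p X a b \<Longrightarrow> step C' p X a b"
  by (erule step.cases) (auto intro: step.intros)

lemma mono_fb_op: "mono fb_op"
proof (rule monoI)
  fix C C' :: answers
  assume le: "C \<subseteq> C'"
  have "halts_with C' e m X k" if "halts_with C e m X k" for e m X k
  proof -
    have "step C (program_of e) X \<le> step C' (program_of e) X"
      using step_mono[OF le] by blast
    then show ?thesis
      using that rtranclp_mono unfolding halts_with_def by blast
  qed
  moreover have "runs_forever C' e m X" if "runs_forever C e m X" for e m X
    using that step_mono[OF le] unfolding runs_forever_def by blast
  ultimately show "fb_op C \<subseteq> fb_op C'"
    unfolding fb_op_def by blast
qed

lemma fb_inf_unfold: "fb_inf = fb_op fb_inf"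
  unfolding fb_inf_def by (rule lfp_unfold[OF mono_fb_op])

lemma fb_defined_iff_dom: "fb_defined e X m \<longleftrightarrow> (e, m, X) \<in> Domain fb_inf"
proof
  assume "(e, m, X) \<in> Domain fb_inf"
  then obtain a where a: "((e, m, X), a) \<in> fb_inf" by blast
  then have "((e, m, X), a) \<in> fb_op fb_inf" using fb_inf_unfold by simp
  then have "a = (Div, \<infinity>) \<or> (\<exists>k. a = (Conv, enat k))"
    unfolding fb_op_def by blast
  with a show "fb_defined e X m"
    unfolding fb_defined_def fb_convergent_def fb_divergent_def by blast
qed (auto simp: fb_defined_def fb_convergent_def fb_divergent_def)

text \<open>The least fixed point is taken among all relations. It is the graph of a partial function, so it
  is also the least fixed point in the sense of partial functions.\<close>

lemma step_deterministic:
  assumes "step C p X a b" and "step C' p X a b'"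
    and agree: "\<And>x y z. (x, y) \<in> C \<Longrightarrow> (x, z) \<in> C' \<Longrightarrow> y = z"
  shows "b = b'"
  using assms(1,2)
  by (elim step.cases) (auto dest: agree)

lemma halted_no_step: "q \<ge> length p \<Longrightarrow> \<not> step C p X (q, T) b"
  by (auto elim: step.cases)

lemma fb_op_agree:
  assumes agree: "\<And>x y z. (x, y) \<in> C \<Longrightarrow> (x, z) \<in> C' \<Longrightarrow> y = z"
    and "(x, y) \<in> fb_op C" "(x, z) \<in> fb_op C'"
  shows "y = z"
proof -
  obtain e m X where x: "x = (e, m, X)" by (cases x)
  let ?p = "program_of e"
  have det: "step C' ?p X a b \<Longrightarrow> step C ?p X a b' \<Longrightarrow> b = b'" for a b b'
    using step_deterministic[of C ?p X a b' C' b] agree by blast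
  have same: "a = b"
    if "(step C ?p X)\<^sup>*\<^sup>* c a" "(step C' ?p X)\<^sup>*\<^sup>* c b"
      "\<And>d. \<not> step C ?p X a d" "\<And>d. \<not> step C' ?p X b d"
      "\<And>d. \<not> step C' ?p X a d" "\<And>d. \<not> step C ?p X b d" for a b c
    using that
  proof (induction rule: converse_rtranclp_induct)
    case base
    then show ?case by (metis converse_rtranclpE)
  next
    case (step c c')
    then show ?case by (metis converse_rtranclpE det)
  qed
  have path: "run n = a"
    if "(step D ?p X ^^ n) (run 0) a" "\<And>n. step D' ?p X (run n) (run (Suc n))"
      "\<And>a b b'. step D ?p X a b \<Longrightarrow> step D' ?p X a b' \<Longrightarrow> b = b'" for D D' n run a
    using that(1)
  proof (induction n arbitrary: a)
    case (Suc n)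
    then obtain b where "(step D ?p X ^^ n) (run 0) b" "step D ?p X b a"
      by (metis relpowp_Suc_E)
    then show ?case using Suc.IH that(2)[of n] that(3) by metis
  qed simp
  have excl: "\<not> runs_forever D' e m X"
    if h: "halts_with D e m X k"
      and "\<And>a b b'. step D ?p X a b \<Longrightarrow> step D' ?p X a b' \<Longrightarrow> b = b'" for D D' k
  proof
    assume "runs_forever D' e m X"
    then obtain run where run: "run 0 = init_config m" "\<And>n. step D' ?p X (run n) (run (Suc n))"
      unfolding runs_forever_def by blast
    obtain q T where qT: "(step D ?p X)\<^sup>*\<^sup>* (run 0) (q, T)" "q \<ge> length ?p"
      using h run(1) unfolding halts_with_def by auto
    then obtain n where "(step D ?p X ^^ n) (run 0) (q, T)"
      using rtranclp_imp_relpowp by fast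
    then have "run n = (q, T)" using path run(2) that(2) by blast
    then show False using run(2)[of n] halted_no_step[OF qT(2)] by metis
  qed
  have hh: "k = k'" if "halts_with C e m X k" "halts_with C' e m X k'" for k k'
  proof -
    obtain q T q' T' where
      "(step C ?p X)\<^sup>*\<^sup>* (init_config m) (q, T)" "q \<ge> length ?p" "k = tape_number (T Work)"
      "(step C' ?p X)\<^sup>*\<^sup>* (init_config m) (q', T')" "q' \<ge> length ?p" "k' = tape_number (T' Work)"
      using \<open>halts_with C e m X k\<close> \<open>halts_with C' e m X k'\<close> unfolding halts_with_def by blast
    moreover from this have "(q, T) = (q', T')"
      by (intro same) (auto simp: halted_no_step)
    ultimately show ?thesis by simp
  qed
  have "\<not> runs_forever C' e m X" if "halts_with C e m X k" for k
    using excl[OF that] det by blast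
  moreover have "\<not> runs_forever C e m X" if "halts_with C' e m X k" for k
    using excl[OF that] det by blast
  ultimately show ?thesis
    using assms(2,3) hh unfolding fb_op_def x by blast
qed

lemma single_valued_fb_inf: "single_valued fb_inf"
proof -
  let ?S = "{(x, y). \<forall>z. (x, z) \<in> fb_inf \<longrightarrow> y = z}"
  have "fb_op ?S \<subseteq> ?S"
  proof safe
    fix e m X j k j' k'
    assume a: "((e, m, X), (j, k)) \<in> fb_op ?S" and "((e, m, X), (j', k')) \<in> fb_inf"
    then have b: "((e, m, X), (j', k')) \<in> fb_op fb_inf" using fb_inf_unfold by simp
    have "(j, k) = (j', k')"
      by (rule fb_op_agree[OF _ a b]) blast
    then show "j = j'" "k = k'" by auto
  qed
  then have "fb_inf \<subseteq> ?S" unfolding fb_inf_def by (rule lfp_lowerbound)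
  then show ?thesis by (auto simp: single_valued_def)
qed

end

(* The program g(e) writes e and its input m on the two query tapes, asks Q^X(e, m), and halts
   whatever the answer. Relative to the least fixed point such a run can continue past the query
   exactly when the query has an answer, i.e. when the computation of e on m is defined. *)

theory Submission
  imports Defs
begin

section \<open>Closure properties of primitive recursive functions\<close>

text \<open>The predicate \<open>prim_rec\<close> is sensitive to the values on lists of the wrong length;
  \<open>pr\<close> is its closure under changing those.\<close>

definition pr :: "nat \<Rightarrow> (nat list \<Rightarrow> nat) \<Rightarrow> bool" where
  "pr n F \<longleftrightarrow> (\<exists>f. prim_rec n f \<and> (\<forall>xs. length xs = n \<longrightarrow> F xs = f xs))"

lemma pr_cong:
  assumes "pr n F" "\<And>xs. length xs = n \<Longrightarrow> G xs = F xs"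
  shows "pr n G"
  using assms unfolding pr_def by auto

lemma pr_proj: "i < n \<Longrightarrow> pr n (\<lambda>xs. xs ! i)"
  unfolding pr_def using prim_rec.proj by blast

text \<open>With \<open>f\<close> acting on numbers instead of lists, a function shown primitive
  recursive on projections can be applied to any argument \<open>a\<close>.\<close>

lemma pr_comp1:
  assumes "pr 1 (\<lambda>xs. f (xs ! 0))" "pr n a"
  shows "pr n (\<lambda>xs. f (a xs))"
proof -
  obtain f' a' where f': "prim_rec 1 f'" "\<And>xs. length xs = 1 \<Longrightarrow> f (xs ! 0) = f' xs"
    and a': "prim_rec n a'" "\<And>xs. length xs = n \<Longrightarrow> a xs = a' xs"
    using assms unfolding pr_def by blast
  have "prim_rec n (\<lambda>xs. f' (map (\<lambda>g. g xs) [a']))"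
    by (rule prim_rec.comp) (use f'(1) a'(1) in auto)
  moreover have "f (a xs) = f' (map (\<lambda>g. g xs) [a'])" if "length xs = n" for xs
    using f'(2)[of "[a' xs]"] a'(2)[OF that] by simp
  ultimately show ?thesis unfolding pr_def by blast
qed

lemma pr_comp2:
  assumes "pr 2 (\<lambda>xs. f (xs ! 0) (xs ! 1))" "pr n a" "pr n b"
  shows "pr n (\<lambda>xs. f (a xs) (b xs))"
proof -
  obtain f' a' b' where
    f': "prim_rec 2 f'" "\<And>xs. length xs = 2 \<Longrightarrow> f (xs ! 0) (xs ! 1) = f' xs"
    and a': "prim_rec n a'" "\<And>xs. length xs = n \<Longrightarrow> a xs = a' xs"
    and b': "prim_rec n b'" "\<And>xs. length xs = n \<Longrightarrow> b xs = b' xs"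
    using assms unfolding pr_def by blast
  have "prim_rec n (\<lambda>xs. f' (map (\<lambda>g. g xs) [a', b']))"
    by (rule prim_rec.comp) (use f'(1) a'(1) b'(1) in \<open>auto simp: numeral_2_eq_2\<close>)
  moreover have "f (a xs) (b xs) = f' (map (\<lambda>g. g xs) [a', b'])" if "length xs = n" for xs
    using f'(2)[of "[a' xs, b' xs]"] a'(2)[OF that] b'(2)[OF that] by simp
  ultimately show ?thesis unfolding pr_def by blast
qed

text \<open>On inputs of length \<open>Suc n\<close> the recursion evaluates \<open>F\<close> only
  at length \<open>n\<close> and \<open>H\<close> only at length \<open>n + 2\<close>, so the
  \<open>prim_rec\<close> representatives \<open>f\<close> and \<open>h\<close> may replace
  them.\<close>

lemma pr_rec:
  assumes "pr n F" "pr (Suc (Suc n)) H"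
  shows "pr (Suc n) (\<lambda>xs. rec_nat (F (tl xs)) (\<lambda>y r. H (y # r # tl xs)) (hd xs))"
proof -
  obtain f h where f: "prim_rec n f" "\<And>xs. length xs = n \<Longrightarrow> F xs = f xs"
    and h: "prim_rec (Suc (Suc n)) h" "\<And>xs. length xs = Suc (Suc n) \<Longrightarrow> H xs = h xs"
    using assms unfolding pr_def by blast
  have "rec_nat (F (tl xs)) (\<lambda>y r. H (y # r # tl xs)) k =
      rec_nat (f (tl xs)) (\<lambda>y r. h (y # r # tl xs)) k" if "length xs = Suc n" for xs k
    using that by (induction k) (auto simp: f(2) h(2))
  then show ?thesis unfolding pr_def using prim_rec.prec[OF f(1) h(1)] by blast
qed

lemma pr_Suc: "pr n a \<Longrightarrow> pr n (\<lambda>xs. Suc (a xs))"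
  by (rule pr_comp1[where f = Suc]) (use prim_rec.suc pr_def in blast)

lemma pr_const: "pr n (\<lambda>_. c)"
proof (induction c)
  case 0
  then show ?case unfolding pr_def using prim_rec.zero by blast
qed (rule pr_Suc)

lemma pr_add:
  assumes "pr n a" "pr n b"
  shows "pr n (\<lambda>xs. a xs + b xs)"
proof -
  \<comment> \<open>In \<open>y # r # tl xs\<close>, position 0 is the recursion variable, 1 the
    previous value, and the parameters follow.\<close>
  have "pr 2 (\<lambda>xs. rec_nat (tl xs ! 0) (\<lambda>y r. Suc ((y # r # tl xs) ! 1)) (hd xs))"
    by (rule pr_rec[where n = 1, unfolded Suc_1]) (simp_all add: pr_proj pr_Suc)
  moreover have "rec_nat i (\<lambda>y. Suc) k = k + i" for i k :: nat
    by (induction k) auto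
  ultimately have "pr 2 (\<lambda>xs. xs ! 0 + xs ! 1)"
    by - (rule pr_cong, assumption, auto simp: numeral_2_eq_2 length_Suc_conv)
  then show ?thesis using assms by (rule pr_comp2[where f = "(+)"])
qed

text \<open>Recursion without parameters: the step returns the recursion variable itself, and the
  start value matches \<open>0 - 1 = 0\<close>.\<close>

lemma pr_pred:
  assumes "pr n a"
  shows "pr n (\<lambda>xs. a xs - 1)"
proof -
  have "pr 1 (\<lambda>xs. rec_nat ((\<lambda>_. 0) (tl xs)) (\<lambda>y r. (y # r # tl xs) ! 0) (hd xs))"
    by (rule pr_rec[where n = 0, folded One_nat_def]) (simp_all add: pr_proj pr_const)
  moreover have "rec_nat 0 (\<lambda>y r. y) k = k - 1" for k :: nat
    by (cases k) auto
  ultimately have "pr 1 (\<lambda>xs. xs ! 0 - 1)"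
    by - (rule pr_cong, assumption, auto simp: length_Suc_conv)
  then show ?thesis using assms by (rule pr_comp1[where f = "\<lambda>k. k - 1"])
qed

text \<open>Iterated predecessor. The recursion runs on the subtrahend, which must come first, so
  the arguments stay swapped until the end.\<close>

lemma pr_diff:
  assumes "pr n a" "pr n b"
  shows "pr n (\<lambda>xs. a xs - b xs)"
proof -
  have "pr 2 (\<lambda>xs. rec_nat (tl xs ! 0) (\<lambda>y r. (y # r # tl xs) ! 1 - 1) (hd xs))"
    by (rule pr_rec[where n = 1 and H = "\<lambda>xs. xs ! 1 - 1", unfolded Suc_1])
      (rule pr_proj pr_pred, simp)+
  moreover have "rec_nat i (\<lambda>y r. r - Suc 0) k = i - k" for i k :: nat
    by (induction k) auto
  ultimately have "pr 2 (\<lambda>xs. xs ! 1 - xs ! 0)"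
    by - (rule pr_cong, assumption, auto simp: numeral_2_eq_2 length_Suc_conv)
  then show ?thesis using assms(2,1) by (rule pr_comp2[where f = "\<lambda>k i. i - k"])
qed

text \<open>Needed for pairing, since
  \<open>prod_encode (m, n) = triangle (m + n) + m\<close>.\<close>

lemma pr_triangle:
  assumes "pr n a"
  shows "pr n (\<lambda>xs. triangle (a xs))"
proof -
  have "pr 1 (\<lambda>xs. rec_nat ((\<lambda>_. 0) (tl xs))
      (\<lambda>y r. (\<lambda>xs. xs ! 1 + Suc (xs ! 0)) (y # r # tl xs)) (hd xs))"
    by (rule pr_rec[where n = 0, folded One_nat_def])
      (intro pr_add pr_Suc pr_proj pr_const; simp)+
  moreover have "rec_nat 0 (\<lambda>y r. Suc (r + y)) k = triangle k" for k :: nat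
    by (induction k) auto
  ultimately have "pr 1 (\<lambda>xs. triangle (xs ! 0))"
    by - (rule pr_cong, assumption, auto simp: length_Suc_conv)
  then show ?thesis using assms by (rule pr_comp1[where f = triangle])
qed

lemma pr_prod_encode: "pr n a \<Longrightarrow> pr n b \<Longrightarrow> pr n (\<lambda>xs. prod_encode (a xs, b xs))"
  unfolding prod_encode_def by (simp add: pr_add pr_triangle)


section \<open>The testing program and its index\<close>

text \<open>States below \<open>e\<close> write the index on \<open>Query1\<close>, one mark each.
  States \<open>e\<close> and \<open>e + 1\<close> form the loop copying the input: a mark on
  \<open>Work\<close> is kept and matched on \<open>Query2\<close>, a blank leads to the query in
  state \<open>e + 2\<close>. Both answers lead to \<open>e + 3\<close>, the length of the program,
  which means halting.\<close>

definition tester :: "nat \<Rightarrow> program" where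
  "tester e = map (\<lambda>k. Move Query1 (True, R, Suc k) (True, R, Suc k)) [0..<e] @
     [Move Work (False, N, e + 2) (True, R, e + 1),
      Move Query2 (True, R, e) (True, R, e),
      FeedbackQuery (e + 3) (e + 3)]"

text \<open>An explicit preimage under \<open>branch_of\<close>, built from pairing so that
  primitive recursiveness can be checked; \<open>d\<close> = 0, 1, 2 codes \<open>L\<close>,
  \<open>N\<close>, \<open>R\<close>.\<close>

definition branch_code :: "bool \<Rightarrow> nat \<Rightarrow> nat \<Rightarrow> nat" where
  "branch_code s d q = prod_encode (of_bool s, prod_encode (d, q))"

definition move_code :: "nat \<Rightarrow> nat \<Rightarrow> nat \<Rightarrow> nat" where
  "move_code t u v = prod_encode (0, prod_encode (t, prod_encode (u, v)))"

definition write_code :: "nat \<Rightarrow> nat \<Rightarrow> nat" where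
  "write_code t q = move_code t (branch_code True 2 q) (branch_code True 2 q)"

definition copy_codes :: "nat \<Rightarrow> nat list" where
  "copy_codes e =
     [move_code 0 (branch_code False 1 (e + 2)) (branch_code True 2 (e + 1)),
      write_code 2 e,
      prod_encode (2, prod_encode (e + 3, e + 3))]"

definition tester_index :: "nat \<Rightarrow> nat" where
  "tester_index e = list_encode (map (\<lambda>k. write_code 1 (Suc k)) [0..<e] @ copy_codes e)"

lemma program_of_tester_index: "program_of (tester_index e) = tester e"
  by (simp add: program_of_def tester_index_def tester_def copy_codes_def write_code_def
      move_code_def branch_code_def instr_of_def branch_of_def tape_id_of_def dir_of_def)

section \<open>Primitive recursiveness of the index function\<close>

lemma pr_write_code: "pr n a \<Longrightarrow> pr n (\<lambda>xs. write_code t (a xs))"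
  unfolding write_code_def move_code_def branch_code_def
  by (intro pr_prod_encode pr_const)

lemma pr_copy_codes: "pr n a \<Longrightarrow> pr n (\<lambda>xs. list_encode (copy_codes (a xs)))"
  unfolding copy_codes_def list_encode.simps move_code_def branch_code_def
  by (intro pr_prod_encode pr_Suc pr_write_code pr_add pr_const)

text \<open>The list of codes is built from its end, so after \<open>j\<close> steps the positions from \<open>e - j\<close>
  on are present.\<close>

lemma rec_nat_tester_codes:
  assumes "j \<le> e"
  shows "rec_nat (list_encode (copy_codes e))
      (\<lambda>j r. Suc (prod_encode (write_code 1 (e - j), r))) j =
    list_encode (map (\<lambda>k. write_code 1 (Suc k)) [e - j..<e] @ copy_codes e)"
  using assms
proof (induction j)
  case (Suc j)
  \<comment> \<open>The new front instruction sits in state \<open>e - Suc j\<close> and continues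
    in its successor \<open>e - j\<close>, the number coded by the recursion step.\<close>
  then have "[e - Suc j..<e] = (e - Suc j) # [e - j..<e]"
    by (simp add: upt_conv_Cons Suc_diff_Suc)
  with Suc show ?case by (simp add: Suc_diff_Suc)
qed simp

lemma primitive_recursive_tester_index: "primitive_recursive tester_index"
proof -
  let ?H = "\<lambda>xs. Suc (prod_encode (write_code 1 (xs ! 2 - xs ! 0), xs ! 1))"
  have "pr 2 (\<lambda>xs. rec_nat (list_encode (copy_codes (tl xs ! 0)))
      (\<lambda>y r. ?H (y # r # tl xs)) (hd xs))"
    by (rule pr_rec[where n = 1, unfolded Suc_1])
      (intro pr_copy_codes pr_prod_encode pr_Suc pr_write_code pr_diff pr_proj; simp)+
  then have "pr 2 (\<lambda>xs. rec_nat (list_encode (copy_codes (xs ! 1)))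
      (\<lambda>j r. Suc (prod_encode (write_code 1 (xs ! 1 - j), r))) (xs ! 0))"
    by - (rule pr_cong, assumption, auto simp: numeral_2_eq_2 length_Suc_conv)
  \<comment> \<open>On the diagonal \<open>j = e\<close> the list starts at position
    \<open>e - e = 0\<close>, so all writing states are present.\<close>
  then have "pr 1 (\<lambda>xs. rec_nat (list_encode (copy_codes (xs ! 0)))
      (\<lambda>j r. Suc (prod_encode (write_code 1 (xs ! 0 - j), r))) (xs ! 0))"
    by (rule pr_comp2[where f = "\<lambda>j e. rec_nat (list_encode (copy_codes e))
      (\<lambda>j r. Suc (prod_encode (write_code 1 (e - j), r))) j"]) (simp_all add: pr_proj)
  then have "pr 1 (\<lambda>xs. tester_index (xs ! 0))"
    by (simp add: rec_nat_tester_codes[simplified] tester_index_def)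
  then show ?thesis unfolding pr_def primitive_recursive_def
    by (metis One_nat_def length_Cons list.size(3) nth_Cons_0)
qed


section \<open>Runs of the testing program\<close>

definition unary_tape :: "nat \<Rightarrow> nat \<Rightarrow> tape" where
  "unary_tape n h = ((\<lambda>i. 0 \<le> i \<and> i < int n), int h)"

lemma tape_number_unary_tape: "tape_number (unary_tape n h) = n"
proof -
  have "{i. 0 \<le> i \<and> i < int n} = {0..<int n}" by auto
  then show ?thesis by (simp add: tape_number_def unary_tape_def)
qed

text \<open>The invariant of the run: \<open>a\<close> marks of the index are written and
  \<open>b\<close> marks of the input are copied.\<close>

fun tester_tapes :: "nat \<Rightarrow> nat \<Rightarrow> nat \<Rightarrow> tape_id \<Rightarrow> tape" where
  "tester_tapes m a b Work = unary_tape m b"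
| "tester_tapes m a b Query1 = unary_tape a a"
| "tester_tapes m a b Query2 = unary_tape b b"

lemma init_config_eq: "init_config m = (0, tester_tapes m 0 0)"
proof -
  have "(if t = Work then number_tape m else number_tape 0) = tester_tapes m 0 0 t" for t
    by (cases t) (auto simp: number_tape_def unary_tape_def)
  then show ?thesis by (auto simp: init_config_def)
qed

lemma length_tester: "length (tester e) = e + 3"
  by (simp add: tester_def)

lemma nth_tester:
  "k < e \<Longrightarrow> tester e ! k = Move Query1 (True, R, Suc k) (True, R, Suc k)"
  "tester e ! e = Move Work (False, N, e + 2) (True, R, e + 1)"
  "tester e ! (e + 1) = Move Query2 (True, R, e) (True, R, e)"
  "tester e ! (e + 2) = FeedbackQuery (e + 3) (e + 3)"
  by (simp_all add: tester_def nth_append)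

lemma step_write_index:
  assumes "a < e"
  shows "step C (tester e) X (a, tester_tapes m a 0) (Suc a, tester_tapes m (Suc a) 0)"
proof -
  let ?T = "tester_tapes m a 0"
  have "step C (tester e) X (a, ?T)
      (Suc a, ?T(Query1 := ((fst (?T Query1))(int a := True), int a + shift R)))"
    by (rule step.move) (use assms in \<open>auto simp: length_tester nth_tester unary_tape_def\<close>)
  moreover have "?T(Query1 := ((fst (?T Query1))(int a := True), int a + shift R)) =
      tester_tapes m (Suc a) 0"
  proof
    fix t show "(?T(Query1 := ((fst (?T Query1))(int a := True), int a + shift R))) t =
      tester_tapes m (Suc a) 0 t"
      by (cases t) (auto simp: unary_tape_def fun_eq_iff)
  qed
  ultimately show ?thesis by simp
qed

lemma steps_copy_mark:
  assumes "b < m"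
  shows "(step C (tester e) X)\<^sup>*\<^sup>* (e, tester_tapes m a b) (e, tester_tapes m a (Suc b))"
proof -
  let ?T = "tester_tapes m a b"
  \<comment> \<open>Between the two steps of the loop the head on \<open>Work\<close> has advanced
    but \<open>Query2\<close> lacks the new mark, so these tapes are not of the form
    \<open>tester_tapes\<close>.\<close>
  let ?T' = "?T(Work := unary_tape m (Suc b))"
  have work: "(fst (?T Work))(int b := True) = fst (?T Work)"
    using assms by (auto simp: unary_tape_def fun_eq_iff)
  have "step C (tester e) X (e, ?T)
      (e + 1, ?T(Work := ((fst (?T Work))(int b := True), int b + shift R)))"
    by (rule step.move) (use assms in \<open>auto simp: length_tester nth_tester unary_tape_def\<close>)
  then have "step C (tester e) X (e, ?T) (e + 1, ?T')"
    unfolding work by (simp add: unary_tape_def add.commute)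
  moreover have "step C (tester e) X (e + 1, ?T')
      (e, ?T'(Query2 := ((fst (?T' Query2))(int b := True), int b + shift R)))"
    by (rule step.move) (auto simp: length_tester nth_tester[simplified] unary_tape_def)
  moreover have "?T'(Query2 := ((fst (?T' Query2))(int b := True), int b + shift R)) =
      tester_tapes m a (Suc b)"
  proof
    fix t show "(?T'(Query2 := ((fst (?T' Query2))(int b := True), int b + shift R))) t =
      tester_tapes m a (Suc b) t"
      by (cases t) (auto simp: unary_tape_def fun_eq_iff)
  qed
  ultimately show ?thesis by auto
qed

lemma step_copy_end:
  "step C (tester e) X (e, tester_tapes m a m) (e + 2, tester_tapes m a m)"
proof -
  let ?T = "tester_tapes m a m"
  have "step C (tester e) X (e, ?T)
      (e + 2, ?T(Work := ((fst (?T Work))(int m := False), int m + shift N)))"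
    by (rule step.move) (auto simp: length_tester nth_tester unary_tape_def)
  moreover have "(fst (?T Work))(int m := False) = fst (?T Work)"
    by (auto simp: unary_tape_def fun_eq_iff)
  moreover have "?T(Work := (fst (?T Work), int m + shift N)) = ?T"
    by (auto simp: unary_tape_def)
  ultimately show ?thesis by simp
qed

text \<open>This holds for arbitrary \<open>C\<close>, as only \<open>Move\<close> instructions are
  executed before state \<open>e + 2\<close>.\<close>

lemma steps_to_query:
  "(step C (tester e) X)\<^sup>*\<^sup>* (init_config m) (e + 2, tester_tapes m e m)"
proof -
  let ?S = "(step C (tester e) X)\<^sup>*\<^sup>*"
  have "?S (init_config m) (a, tester_tapes m a 0)" if "a \<le> e" for a
    using that
  proof (induction a)
    case (Suc a)
    then have "?S (init_config m) (a, tester_tapes m a 0)" "a < e" by simp_all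
    then show ?case
      by (blast intro: rtranclp.rtrancl_into_rtrancl step_write_index)
  qed (simp add: init_config_eq)
  then have "?S (init_config m) (e, tester_tapes m e 0)" by simp
  also have "?S (e, tester_tapes m e 0) (e, tester_tapes m e b)" if "b \<le> m" for b
    using that
  proof (induction b)
    case (Suc b)
    then have "?S (e, tester_tapes m e 0) (e, tester_tapes m e b)" "b < m" by simp_all
    then show ?case by (blast intro: rtranclp_trans steps_copy_mark)
  qed simp
  then have "?S (e, tester_tapes m e 0) (e, tester_tapes m e m)" by simp
  also have "?S (e, tester_tapes m e m) (e + 2, tester_tapes m e m)"
    using step_copy_end by (rule r_into_rtranclp)
  finally show ?thesis .
qed

section \<open>The query and halting\<close>

lemma step_query_iff:
  "(\<exists>c. step C (tester e) X (e + 2, tester_tapes m e m) c) \<longleftrightarrow> (e, m, X) \<in> Domain C"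
proof
  assume "\<exists>c. step C (tester e) X (e + 2, tester_tapes m e m) c"
  then show "(e, m, X) \<in> Domain C"
    by (auto elim!: step.cases simp: nth_tester[simplified] tape_number_unary_tape)
next
  assume "(e, m, X) \<in> Domain C"
  then obtain j k where "((e, m, X), (j, k)) \<in> C" by auto
  then have "step C (tester e) X (e + 2, tester_tapes m e m)
      (case j of Conv \<Rightarrow> e + 3 | Div \<Rightarrow> e + 3, tester_tapes m e m)"
    by (intro step.feedback) (simp_all add: length_tester nth_tester[simplified] tape_number_unary_tape)
  then show "\<exists>c. step C (tester e) X (e + 2, tester_tapes m e m) c" ..
qed

lemma step_query_target:
  assumes "step C (tester e) X (e + 2, T) c"
  shows "c = (e + 3, T)"
  using assms by (auto elim!: step.cases simp: nth_tester[simplified] split: answer.split)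

text \<open>Paths of a deterministic relation do not branch, and the one from \<open>a\<close> to
  \<open>b\<close> cannot continue beyond the final element \<open>c\<close>.\<close>

lemma rtranclp_normal_form_via:
  assumes det: "\<And>x y z. r x y \<Longrightarrow> r x z \<Longrightarrow> y = z"
    and "r\<^sup>*\<^sup>* a b" "r\<^sup>*\<^sup>* a c" "\<And>d. \<not> r c d"
  shows "r\<^sup>*\<^sup>* b c"
  using assms(2,3)
proof (induction rule: converse_rtranclp_induct)
  case (step x y)
  then show ?case using assms(4) det by (metis converse_rtranclpE)
qed

text \<open>Single-valuedness of \<open>C\<close> makes \<open>step C\<close> deterministic, so
  every halting run passes through the query configuration.\<close>

lemma ex_halts_with_tester_index_iff:
  assumes "single_valued C"
  shows "(\<exists>k. halts_with C (tester_index e) m X k) \<longleftrightarrow> (e, m, X) \<in> Domain C"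
proof
  let ?r = "step C (tester e) X"
  let ?c = "(e + 2, tester_tapes m e m)"
  assume "\<exists>k. halts_with C (tester_index e) m X k"
  then obtain q T where run: "?r\<^sup>*\<^sup>* (init_config m) (q, T)" "length (tester e) \<le> q"
    unfolding halts_with_def program_of_tester_index by blast
  have "?r\<^sup>*\<^sup>* ?c (q, T)"
  proof (rule rtranclp_normal_form_via[OF _ steps_to_query run(1)])
    show "y = z" if "?r x y" "?r x z" for x y z
      using step_deterministic[OF that] assms by (auto simp: single_valued_def)
  qed (rule halted_no_step[OF run(2)])
  \<comment> \<open>State \<open>e + 2\<close> lies inside the program and \<open>q\<close> outside,
    so the path between them is nonempty; its first step is an answered query.\<close>
  moreover have "?c \<noteq> (q, T)" using run(2) by (auto simp: length_tester)
  ultimately have "\<exists>c. ?r ?c c" by (metis converse_rtranclpE)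
  then show "(e, m, X) \<in> Domain C" by (simp only: step_query_iff)
next
  let ?r = "step C (tester e) X"
  assume "(e, m, X) \<in> Domain C"
  then have "?r (e + 2, tester_tapes m e m) (e + 3, tester_tapes m e m)"
    using step_query_iff step_query_target by metis
  with steps_to_query have "?r\<^sup>*\<^sup>* (init_config m) (e + 3, tester_tapes m e m)"
    by (rule rtranclp.rtrancl_into_rtrancl)
  then show "\<exists>k. halts_with C (tester_index e) m X k"
    unfolding halts_with_def program_of_tester_index length_tester by blast
qed

lemma fb_convergent_iff: "fb_convergent e X m \<longleftrightarrow> (\<exists>k. halts_with fb_inf e m X k)"
  unfolding fb_convergent_def by (subst fb_inf_unfold) (auto simp: fb_op_def)

theorem lemma1p8:
  "\<exists>g :: nat \<Rightarrow> nat. primitive_recursive g \<and>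
     (\<forall>(e :: nat) (m :: nat) (X :: nat \<Rightarrow> nat).
        fb_convergent (g e) X m \<longleftrightarrow> fb_defined e X m)"
  \<comment> \<open>The witness is \<open>tester_index\<close>, with \<open>C\<close> taken to be
    the fixed point \<open>fb_inf\<close>.\<close>
  using primitive_recursive_tester_index
    ex_halts_with_tester_index_iff[OF single_valued_fb_inf]
  unfolding fb_convergent_iff fb_defined_iff_dom by blast

end
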